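(* Let $b_\square(n)$ be the number of similar sublattices of index $n$ of the square lattice $\mathbb{Z}[\mathrm{i}]\subset\mathbb{R}^2$, and $b^{\mathsf{pr}}_\square(n)$ the number of primitive similar sublattices of index $n$. Then, as $x\to\infty$, $$\sum_{n\le x}b_\square(n)=L(1,\chi_{-4})\,x+O(\sqrt x)=\frac\pi4x+O(\sqrt x),$$ $$\sum_{n\le x}b^{\mathsf{pr}}_\square(n)=\frac{L(1,\chi_{-4})}{\zeta(2)}x+O(\sqrt x\log x)=\frac{3}{2\pi}x+O(\sqrt x\log x).$$
   Context: A similar sublattice of a lattice $\Gamma$ is a sublattice of the form $\alpha R\Gamma\subseteq\Gamma$ with $\alpha>0$ and $R$ orthogonal; it is primitive if it is not of the form $m\Lambda$ with $\Lambda$ a similar sublattice of $\Gamma$ and $m\ge2$ an integer. Equivalently, $\sum_n b_\square(n)n^{-s}=\zeta(s)L(s,\chi_{-4})$ and $\sum_n b^{\mathsf{pr}}_\square(n)n^{-s}=\zeta(s)L(s,\chi_{-4})/\zeta(2s)$, where $L(s,\chi_{-4})=\sum_n\chi_{-4}(n)n^{-s}$ with $\chi_{-4}(n)=0$ for $n$ even, $1$ for $n\equiv1\pmod4$, $-1$ for $n\equiv3\pmod4$. *)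

theory Defs
  imports "HOL-Analysis.Analysis" "HOL-Library.Landau_Symbols"
begin

definition similar_sublattice :: "'a::euclidean_space set \<Rightarrow> 'a set \<Rightarrow> bool" where
  "similar_sublattice \<Gamma> \<Lambda> \<longleftrightarrow>
     (\<exists>\<alpha>>0. \<exists>R. orthogonal_transformation R \<and> \<Lambda> = (\<lambda>x. \<alpha> *\<^sub>R R x) ` \<Gamma>) \<and> \<Lambda> \<subseteq> \<Gamma>"

definition primitive_similar_sublattice :: "'a::euclidean_space set \<Rightarrow> 'a set \<Rightarrow> bool" where
  "primitive_similar_sublattice \<Gamma> \<Lambda> \<longleftrightarrow>
     similar_sublattice \<Gamma> \<Lambda> \<and>
     \<not> (\<exists>m::nat. m \<ge> 2 \<and>
          (\<exists>\<Lambda>'. similar_sublattice \<Gamma> \<Lambda>' \<and> \<Lambda> = (\<lambda>x. real m *\<^sub>R x) ` \<Lambda>'))"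

text \<open>The index is the number of cosets; an infinite index is represented by 0
  (this does not occur for similar sublattices of a lattice).\<close>

definition lattice_index :: "'a::euclidean_space set \<Rightarrow> 'a set \<Rightarrow> nat" where
  "lattice_index \<Gamma> \<Lambda> = card (\<Gamma> // {(x, y). x \<in> \<Gamma> \<and> y \<in> \<Gamma> \<and> x - y \<in> \<Lambda>})"

definition square_lattice :: "complex set" where
  "square_lattice = {of_int a + of_int b * \<i> | a b :: int. True}"

definition b_square :: "nat \<Rightarrow> nat" where
  "b_square n = card {\<Lambda>. similar_sublattice square_lattice \<Lambda> \<and>
                           lattice_index square_lattice \<Lambda> = n}"

definition b_square_pr :: "nat \<Rightarrow> nat" where
  "b_square_pr n = card {\<Lambda>. primitive_similar_sublattice square_lattice \<Lambda> \<and>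
                              lattice_index square_lattice \<Lambda> = n}"

definition chi_minus4 :: "nat \<Rightarrow> real" where
  "chi_minus4 n = (if even n then 0 else if n mod 4 = 1 then 1 else -1)"

text \<open>The Dirichlet series start at 1, hence the shift of the summation index. They are
  summed as ordinary series, so that conditional convergence is allowed: the series of
  \<^term>\<open>chi_minus4\<close> converges exactly for real \<open>s > 0\<close>, that of zeta for \<open>s > 1\<close>.\<close>

definition dirichlet_L :: "(nat \<Rightarrow> real) \<Rightarrow> real \<Rightarrow> real" where
  "dirichlet_L c s = (\<Sum>n. c (Suc n) * real (Suc n) powr (-s))"

definition riemann_zeta :: "real \<Rightarrow> real" where
  "riemann_zeta s = (\<Sum>n. real (Suc n) powr (-s))"

end

theory Submission
  imports Defs "HOL-Computational_Algebra.Squarefree"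
begin

text \<open>
  An orthogonal map of the plane is determined up to conjugation by the image of 1, and conjugation
  preserves \<open>\<int>[\<i>]\<close>; hence the similar sublattices are the principal ideals \<open>z\<int>[\<i>]\<close> with
  \<open>z \<noteq> 0\<close>. Such an ideal has index \<open>|z|\<^sup>2\<close>, is primitive iff the coordinates of \<open>z\<close> are coprime,
  and has exactly four generators. So \<open>4 \<Sum>\<^sub>n\<^sub>\<le>\<^sub>x b(n)\<close> counts the nonzero lattice points in the disc of
  radius \<open>\<surd>x\<close>, which by comparison with the area is \<open>\<pi>x + O(\<surd>x)\<close>. Moebius inversion over the common
  divisors of the coordinates gives the primitive count, where \<open>\<Sum>\<^sub>d \<mu>(d)/d\<^sup>2 = 1/\<zeta>(2) = 6/\<pi>\<^sup>2\<close> and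
  the errors \<open>O(\<surd>x/d)\<close> add up to \<open>O(\<surd>x log x)\<close>. The constants agree by Leibniz's series
  \<open>L(1, \<chi>) = \<pi>/4\<close>.
\<close>

section \<open>Similar sublattices as principal ideals\<close>

text \<open>The generator is a pair of integers instead of a complex number, so that gcd,
  divisibility and signs can be read off its coordinates.\<close>

definition gaussian_ideal :: "int \<times> int \<Rightarrow> complex set" where
  "gaussian_ideal p = (\<lambda>w. Complex (fst p) (snd p) * w) ` square_lattice"

text \<open>A fundamental domain for multiplication by the units 1, \<open>\<i>\<close>, -1,
  \<open>- \<i>\<close> on the nonzero Gaussian integers; one of the two bounding half-axes has to
  be left out.\<close>

definition quadrant :: "(int \<times> int) set" where
  "quadrant = {p. 0 < fst p \<and> 0 \<le> snd p}"

definition sq_norm :: "int \<times> int \<Rightarrow> int" where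
  "sq_norm p = (fst p)\<^sup>2 + (snd p)\<^sup>2"

lemma square_lattice_eq: "square_lattice = {Complex (of_int a) (of_int b) | a b. True}"
proof -
  have "of_int a + of_int b * \<i> = Complex (of_int a) (of_int b)" for a b :: int
    by (simp add: complex_eq_iff)
  then show ?thesis
    unfolding square_lattice_def by simp
qed

lemma Complex_of_int_in_square_lattice [simp]:
  "Complex (of_int a) (of_int b) \<in> square_lattice"
  unfolding square_lattice_eq by blast

lemma square_lattice_cases:
  assumes "z \<in> square_lattice"
  obtains a b :: int where "z = Complex (of_int a) (of_int b)"
  using assms unfolding square_lattice_eq by blast

text \<open>The right-hand side is the product (a + bi)(p + qi) in coordinates; it reduces questions
  about ideals to integer arithmetic.\<close>

lemma Complex_of_int_in_gaussian_ideal_iff: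
  "Complex (of_int x) (of_int y) \<in> gaussian_ideal (a, b) \<longleftrightarrow>
     (\<exists>p q. x = a * p - b * q \<and> y = b * p + a * q)"
proof -
  have "Complex (of_int a) (of_int b) * Complex (of_int p) (of_int q)
     = Complex (of_int (a * p - b * q)) (of_int (b * p + a * q))" for p q
    by (simp add: complex_eq_iff algebra_simps)
  then have "gaussian_ideal (a, b)
      = {Complex (of_int (a * p - b * q)) (of_int (b * p + a * q)) | p q. True}"
    unfolding gaussian_ideal_def square_lattice_eq image_Collect fst_conv snd_conv
    by (intro Collect_cong) (metis (no_types))
  then show ?thesis
    by (simp only: mem_Collect_eq complex.inject of_int_eq_iff) simp
qed

lemma gaussian_ideal_subset: "gaussian_ideal p \<subseteq> square_lattice"
proof -
  have "Complex (of_int a) (of_int b) * Complex (of_int p) (of_int q)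
     = Complex (of_int (a * p - b * q)) (of_int (b * p + a * q))" for a b p q
    by (simp add: complex_eq_iff algebra_simps)
  then show ?thesis
    unfolding gaussian_ideal_def
    by (auto elim!: square_lattice_cases simp del: of_int_diff of_int_add of_int_mult)
qed

lemma gaussian_ideal_generator: "Complex (of_int (fst p)) (of_int (snd p)) \<in> gaussian_ideal p"
proof -
  have "1 = Complex (of_int 1) (of_int 0)" by (simp add: complex_eq_iff)
  then have "1 \<in> square_lattice" by (metis Complex_of_int_in_square_lattice)
  then show ?thesis unfolding gaussian_ideal_def by force
qed

text \<open>Let z be the generator and \<open>g\<close> the gcd of its coordinates. The imaginary
  parts of the ideal fill the multiples of \<open>g\<close>, and its real elements are the multiples
  of \<open>M\<close> = |z|^2 / g, so there are \<open>M * g\<close> = |z|^2 cosets.\<close>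

lemma lattice_index_gaussian_ideal:
  assumes "p \<noteq> (0, 0)"
  shows "int (lattice_index square_lattice (gaussian_ideal p)) = sq_norm p"
proof -
  obtain a b where p: "p = (a, b)" by (cases p)
  define g where "g = gcd a b"
  have ab: "a \<noteq> 0 \<or> b \<noteq> 0" using assms p by auto
  then have g0: "g > 0" unfolding g_def by simp
  obtain a' b' where a': "a = g * a'" and b': "b = g * b'" and cop: "coprime a' b'"
    using gcd_coprime_exists[of a b] g0 unfolding g_def
    by (metis less_irrefl mult.commute)
  define M where "M = g * (a'\<^sup>2 + b'\<^sup>2)"
  have "a' \<noteq> 0 \<or> b' \<noteq> 0" using ab a' b' by auto
  then have M0: "M > 0"
    unfolding M_def using g0 by (simp add: sum_power2_gt_zero_iff)
  have norm: "M * g = a\<^sup>2 + b\<^sup>2"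
    unfolding M_def a' b' by (simp add: power2_eq_square algebra_simps)
  \<comment> \<open>The Bezout coefficients produce the ideal element z (s + ti) with imaginary part
    \<open>g\<close>; its real part is \<open>s * a - t * b\<close>.\<close>
  obtain s t where st: "s * b + t * a = g"
    using bezout_int[of b a] unfolding g_def by (metis gcd.commute)
  define R where "R = {(x, y). x \<in> square_lattice \<and> y \<in> square_lattice \<and> x - y \<in> gaussian_ideal p}"
  have R_iff: "(Complex (of_int x) (of_int y), Complex (of_int x') (of_int y')) \<in> R \<longleftrightarrow>
      (\<exists>p q. x - x' = a * p - b * q \<and> y - y' = b * p + a * q)" for x y x' y'
  proof -
    have "Complex (of_int x) (of_int y) - Complex (of_int x') (of_int y')
        = Complex (of_int (x - x')) (of_int (y - y'))" by (simp add: complex_eq_iff)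
    then show ?thesis unfolding R_def p
      by (simp add: Complex_of_int_in_gaussian_ideal_iff del: of_int_diff)
  qed
  have "equiv square_lattice R"
  proof (rule equivI)
    show "R \<subseteq> square_lattice \<times> square_lattice" unfolding R_def by auto
    show "refl_on square_lattice R"
    proof (rule refl_onI)
      fix z assume "z \<in> square_lattice"
      then obtain x y where z: "z = Complex (of_int x) (of_int y)" by (rule square_lattice_cases)
      show "(z, z) \<in> R" unfolding z R_iff by (rule exI[of _ 0], rule exI[of _ 0]) simp
    qed
    show "sym R"
    proof (rule symI)
      fix z w assume zw: "(z, w) \<in> R"
      then have "z \<in> square_lattice" "w \<in> square_lattice" unfolding R_def by auto
      then obtain x y x' y' where z: "z = Complex (of_int x) (of_int y)"
        "w = Complex (of_int x') (of_int y')" by (metis square_lattice_cases)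
      from zw obtain p q where "x - x' = a * p - b * q" "y - y' = b * p + a * q"
        unfolding z R_iff by blast
      then have "x' - x = a * (-p) - b * (-q)" "y' - y = b * (-p) + a * (-q)" by auto
      then show "(w, z) \<in> R" unfolding z R_iff by blast
    qed
    show "trans R"
    proof (rule transI)
      fix z w v assume zw: "(z, w) \<in> R" "(w, v) \<in> R"
      then have "z \<in> square_lattice" "w \<in> square_lattice" "v \<in> square_lattice"
        unfolding R_def by auto
      then obtain x y x' y' x'' y'' where z: "z = Complex (of_int x) (of_int y)"
        "w = Complex (of_int x') (of_int y')" "v = Complex (of_int x'') (of_int y'')"
        by (metis square_lattice_cases)
      from zw obtain p q p' q' where "x - x' = a * p - b * q" "y - y' = b * p + a * q"
        "x' - x'' = a * p' - b * q'" "y' - y'' = b * p' + a * q'"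
        unfolding z R_iff by blast
      then have "x - x'' = a * (p + p') - b * (q + q')" "y - y'' = b * (p + p') + a * (q + q')"
        by (auto simp: algebra_simps)
      then show "(z, v) \<in> R" unfolding z R_iff by blast
    qed
  qed
  \<comment> \<open>The ideal has the triangular basis \<open>M\<close>, \<open>c + g\<i>\<close>, so the box \<open>[0, M) \<times> [0, g)\<close>
    is a system of coset representatives.\<close>
  define f where "f = (\<lambda>(x::int, y::int). R `` {Complex (of_int x) (of_int y)})"
  have "bij_betw f ({0..<M} \<times> {0..<g}) (square_lattice // R)"
  proof (rule bij_betw_imageI)
    show "inj_on f ({0..<M} \<times> {0..<g})"
    proof (rule inj_onI, clarify)
      fix x y x' y' assume xy: "x \<in> {0..<M}" "y \<in> {0..<g}" "x' \<in> {0..<M}" "y' \<in> {0..<g}"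
        and "f (x, y) = f (x', y')"
      then have "(Complex (of_int x) (of_int y), Complex (of_int x') (of_int y')) \<in> R"
        unfolding f_def using eq_equiv_class_iff[OF \<open>equiv square_lattice R\<close>] by simp
      then obtain p q where pq: "x - x' = a * p - b * q" "y - y' = b * p + a * q"
        unfolding R_iff by blast
      have "g dvd y - y'" unfolding pq a' b' by (simp add: mult.assoc)
      then have y: "y = y'" using xy
        by (auto dest!: zdvd_imp_le[rotated] simp: abs_if)
           (smt (verit) zdvd_not_zless dvd_minus_iff)
      then have "g * (b' * p + a' * q) = 0" using pq(2) unfolding a' b'
        by (simp add: algebra_simps)
      then have 0: "b' * p = a' * (-q)" using g0 by simp
      then have "a' dvd b' * p" by simp
      then have "a' dvd p" using cop by (simp add: coprime_dvd_mult_right_iff)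
      then obtain k where k: "p = a' * k" by blast
      have "M dvd x - x'"
      \<comment> \<open>If \<open>a'\<close> is 0 it cannot be cancelled from the equation, but then
        coprimality makes \<open>b'\<close> a unit and \<open>M\<close> collapses to
        \<open>g\<close>.\<close>
      proof (cases "a' = 0")
        case True
        then have "b' * b' = 1" using cop by (simp add: zmult_eq_1_iff)
            (metis abs_mult_self_eq mult_1 zmult_eq_1_iff)
        with True have "M = g" unfolding M_def by (simp add: power2_eq_square)
        then show ?thesis unfolding pq a' b' by (simp add: mult.assoc)
      next
        case False
        have "a' * (b' * k) = a' * (- q)" using 0 k by (simp add: algebra_simps)
        with False have "b' * k = - q" by (metis mult_left_cancel)
        then have "q = - b' * k" by simp
        then have "x - x' = M * k"
          using pq(1) k unfolding a' b' M_def by (simp add: algebra_simps power2_eq_square)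
        then show ?thesis by simp
      qed
      then have x: "x = x'" using xy
        by (auto dest!: zdvd_imp_le[rotated] simp: abs_if)
           (smt (verit) zdvd_not_zless dvd_minus_iff)
      show "x = x' \<and> y = y'" using x y by simp
    qed
    show "f ` ({0..<M} \<times> {0..<g}) = square_lattice // R"
    proof
      show "f ` ({0..<M} \<times> {0..<g}) \<subseteq> square_lattice // R"
        unfolding f_def by (auto intro: quotientI)
      show "square_lattice // R \<subseteq> f ` ({0..<M} \<times> {0..<g})"
      proof
        fix X assume "X \<in> square_lattice // R"
        then obtain z where "z \<in> square_lattice" and X: "X = R `` {z}" by (auto elim: quotientE)
        then obtain x y where z: "z = Complex (of_int x) (of_int y)" by (blast elim: square_lattice_cases)
        \<comment> \<open>Reduction modulo the ideal: subtracting \<open>k\<close> times z (s + ti)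
          brings the imaginary part into [0, g) and leaves the real part \<open>x1\<close>; then
          \<open>l\<close> times M = z (a' - b'i) is subtracted. In total z (p' + q'i) is
          removed.\<close>
        define k where "k = y div g"
        define x1 where "x1 = x - k * (s * a - t * b)"
        define l where "l = x1 div M"
        define p' where "p' = k * s + l * a'"
        define q' where "q' = k * t - l * b'"
        have "x - x1 mod M = a * p' - b * q'"
        proof -
          have "x1 mod M = x1 - M * l" unfolding l_def by (simp add: minus_mult_div_eq_mod)
          then show ?thesis unfolding p'_def q'_def x1_def M_def a' b'
            by (simp add: algebra_simps power2_eq_square)
        qed
        moreover have "y - y mod g = b * p' + a * q'"
        proof -
          have "y - y mod g = g * k" unfolding k_def by (simp add: minus_mod_eq_mult_div)
          also have "\<dots> = k * (s * b + t * a)" using st by simp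
          also have "\<dots> = b * p' + a * q'" unfolding p'_def q'_def  a' b'
            by (simp add: algebra_simps)
          finally show ?thesis .
        qed
        ultimately have "(z, Complex (of_int (x1 mod M)) (of_int (y mod g))) \<in> R"
          unfolding z R_iff by blast
        then have "X = f (x1 mod M, y mod g)"
          unfolding X f_def using equiv_class_eq[OF \<open>equiv square_lattice R\<close>] by simp
        moreover have "(x1 mod M, y mod g) \<in> {0..<M} \<times> {0..<g}" using M0 g0 by simp
        ultimately show "X \<in> f ` ({0..<M} \<times> {0..<g})" by blast
      qed
    qed
  qed
  then have "card (square_lattice // R) = card ({0..<M} \<times> {0..<g})"
    by (metis bij_betw_same_card)
  then have "int (card (square_lattice // R)) = M * g"
    using M0 g0 by (simp add: card_cartesian_product)
  then show ?thesis unfolding lattice_index_def R_def norm p sq_norm_def by simp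
qed

section \<open>Generators up to multiplication by units\<close>

lemma gaussian_ideal_quarter_turn: "gaussian_ideal (- b, a) = gaussian_ideal (a, b)"
proof -
  have "Complex (of_int x) (of_int y) \<in> gaussian_ideal (- b, a) \<longleftrightarrow>
        Complex (of_int x) (of_int y) \<in> gaussian_ideal (a, b)" for x y
  proof
    assume "Complex (of_int x) (of_int y) \<in> gaussian_ideal (- b, a)"
    then obtain p q where "x = - b * p - a * q" "y = a * p + - b * q"
      unfolding Complex_of_int_in_gaussian_ideal_iff by blast
    then have "x = a * (- q) - b * p" "y = b * (- q) + a * p" by simp_all
    then show "Complex (of_int x) (of_int y) \<in> gaussian_ideal (a, b)"
      unfolding Complex_of_int_in_gaussian_ideal_iff by blast
  next
    assume "Complex (of_int x) (of_int y) \<in> gaussian_ideal (a, b)"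
    then obtain p q where "x = a * p - b * q" "y = b * p + a * q"
      unfolding Complex_of_int_in_gaussian_ideal_iff by blast
    then have "x = - b * q - a * (- p)" "y = a * q + - b * (- p)" by simp_all
    then show "Complex (of_int x) (of_int y) \<in> gaussian_ideal (- b, a)"
      unfolding Complex_of_int_in_gaussian_ideal_iff by blast
  qed
  then show ?thesis
    using gaussian_ideal_subset[of "(- b, a)"] gaussian_ideal_subset[of "(a, b)"]
    by (intro set_eqI) (auto elim!: square_lattice_cases dest!: subsetD)
qed

text \<open>The four associates of a nonzero point are its images under quarter turns, and one of
  them lies in the fundamental domain.\<close>

lemma gaussian_ideal_in_quadrant:
  assumes "p \<noteq> (0, 0)"
  shows "\<exists>q\<in>quadrant. gaussian_ideal q = gaussian_ideal p"
proof -
  obtain a b where p: "p = (a, b)" by (cases p)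
  have *: "gaussian_ideal (- b, a) = gaussian_ideal (a, b)"
    "gaussian_ideal (- a, - b) = gaussian_ideal (a, b)"
    "gaussian_ideal (b, - a) = gaussian_ideal (a, b)"
    using gaussian_ideal_quarter_turn[of b a] gaussian_ideal_quarter_turn[of a "- b"]
      gaussian_ideal_quarter_turn[of "- b" "- a"] by simp_all
  have "(a, b) \<in> quadrant \<or> (- b, a) \<in> quadrant \<or> (- a, - b) \<in> quadrant \<or> (b, - a) \<in> quadrant"
    using assms unfolding p quadrant_def by auto
  then show ?thesis unfolding p using * by metis
qed

text \<open>Two generators of the same ideal divide each other, so their quotient has norm 1 and is
  a unit; among the four units only 1 maps a point of the quadrant into the quadrant.\<close>

lemma inj_on_gaussian_ideal: "inj_on gaussian_ideal quadrant"
proof (rule inj_onI)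
  fix u v assume uv: "u \<in> quadrant" "v \<in> quadrant" and eq: "gaussian_ideal u = gaussian_ideal v"
  obtain a b c d where u: "u = (a, b)" and v: "v = (c, d)" by (cases u, cases v)
  have abcd: "a > 0" "b \<ge> 0" "c > 0" "d \<ge> 0" using uv unfolding u v quadrant_def by auto
  have "Complex (of_int a) (of_int b) \<in> gaussian_ideal (c, d)"
    using gaussian_ideal_generator[of u] eq unfolding u v by simp
  then obtain p q where pq: "a = c * p - d * q" "b = d * p + c * q"
    unfolding Complex_of_int_in_gaussian_ideal_iff by blast
  have "Complex (of_int c) (of_int d) \<in> gaussian_ideal (a, b)"
    using gaussian_ideal_generator[of v] eq unfolding u v by simp
  then obtain p' q' where pq': "c = a * p' - b * q'" "d = b * p' + a * q'"
    unfolding Complex_of_int_in_gaussian_ideal_iff by blast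
  \<comment> \<open>Multiplicativity of the norm, applied to both divisibilities.\<close>
  have 1: "a\<^sup>2 + b\<^sup>2 = (c\<^sup>2 + d\<^sup>2) * (p\<^sup>2 + q\<^sup>2)"
    unfolding pq by (simp add: power2_eq_square algebra_simps)
  have 2: "c\<^sup>2 + d\<^sup>2 = (a\<^sup>2 + b\<^sup>2) * (p'\<^sup>2 + q'\<^sup>2)"
    unfolding pq' by (simp add: power2_eq_square algebra_simps)
  have "(a\<^sup>2 + b\<^sup>2) * ((p'\<^sup>2 + q'\<^sup>2) * (p\<^sup>2 + q\<^sup>2)) = a\<^sup>2 + b\<^sup>2"
    using 1 2 by (simp add: mult.assoc)
  then have "(p'\<^sup>2 + q'\<^sup>2) * (p\<^sup>2 + q\<^sup>2) = 1" using abcd by simp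
  then have pq1: "p\<^sup>2 + q\<^sup>2 = 1"
    using sum_power2_ge_zero[of p q] by (auto simp: zmult_eq_1_iff)
  have "p\<^sup>2 \<le> 1" "q\<^sup>2 \<le> 1" using pq1 by (smt (verit) zero_le_power2)+
  then have "\<bar>p\<bar> \<le> 1" "\<bar>q\<bar> \<le> 1" by (simp_all add: abs_square_le_1)
  then have "p \<in> {-1, 0, 1}" "q \<in> {-1, 0, 1}" by auto
  with pq1 have "(p, q) \<in> {(1, 0), (-1, 0), (0, 1), (0, -1)}" by auto
  with abcd pq show "u = v" unfolding u v by auto
qed

text \<open>The generator is the image \<open>\<alpha> *\<^sub>R R 1\<close> of 1, a lattice point
  because the image lies in the lattice. Conversely, multiplication by z is the rotation by
  \<open>sgn z\<close> followed by scaling with \<open>norm z\<close>.\<close>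

lemma similar_sublattice_square_lattice_iff:
  "similar_sublattice square_lattice \<Lambda> \<longleftrightarrow> (\<exists>p. p \<noteq> (0, 0) \<and> \<Lambda> = gaussian_ideal p)"
proof
  assume "similar_sublattice square_lattice \<Lambda>"
  then obtain \<alpha> R where \<alpha>: "\<alpha> > 0" and R: "orthogonal_transformation R"
    and \<Lambda>: "\<Lambda> = (\<lambda>x. \<alpha> *\<^sub>R R x) ` square_lattice" and sub: "\<Lambda> \<subseteq> square_lattice"
    unfolding similar_sublattice_def by blast
  have lin: "linear R" using R by (rule orthogonal_transformation_linear)
  have "1 = Complex (of_int 1) (of_int 0)" by (simp add: complex_eq_iff)
  then have "1 \<in> square_lattice" by (metis Complex_of_int_in_square_lattice)
  then have "\<alpha> *\<^sub>R R 1 \<in> square_lattice" using sub \<Lambda> by blast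
  then obtain a b where ab: "\<alpha> *\<^sub>R R 1 = Complex (of_int a) (of_int b)"
    by (rule square_lattice_cases)
  have n1: "norm (R 1) = 1" "norm (R \<i>) = 1"
    using R by (simp_all add: orthogonal_transformation)
  have "R 1 \<bullet> R \<i> = 1 \<bullet> \<i>" using R by (simp add: orthogonal_transformation_def)
  then have o: "Re (R 1) * Re (R \<i>) + Im (R 1) * Im (R \<i>) = 0"
    by (simp add: inner_complex_def)
  have n: "(Re (R 1))\<^sup>2 + (Im (R 1))\<^sup>2 = 1" "(Re (R \<i>))\<^sup>2 + (Im (R \<i>))\<^sup>2 = 1"
    using n1 by (simp_all add: cmod_def)
  \<comment> \<open>\<open>R 1\<close> and \<open>R \<i>\<close> are orthonormal, so they differ by
    a quarter turn in one of the two directions.\<close>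
  have Ri: "R \<i> = \<i> * R 1 \<or> R \<i> = - \<i> * R 1"
  proof -
    define c s u v where "c = Re (R 1)" and "s = Im (R 1)" and "u = Re (R \<i>)" and "v = Im (R \<i>)"
    have eqs: "c * u + s * v = 0" "c\<^sup>2 + s\<^sup>2 = 1" "u\<^sup>2 + v\<^sup>2 = 1"
      using o n unfolding c_def s_def u_def v_def by auto
    \<comment> \<open>\<open>k\<close> is the determinant of \<open>R\<close>; Lagrange's identity
      gives \<open>k\<close> = 1 or -1, and then \<open>R \<i>\<close> is determined by
      \<open>R 1\<close> and \<open>k\<close>.\<close>
    define k where "k = c * v - s * u"
    have "k\<^sup>2 = (c\<^sup>2 + s\<^sup>2) * (u\<^sup>2 + v\<^sup>2) - (c * u + s * v)\<^sup>2"
      unfolding k_def by (simp add: power2_eq_square algebra_simps)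
    then have k: "k = 1 \<or> k = -1" using eqs by (simp add: power2_eq_1_iff)
    have "u * (c\<^sup>2 + s\<^sup>2) = c * (c * u + s * v) - s * k"
      unfolding k_def by (simp add: power2_eq_square algebra_simps)
    then have u: "u = - s * k" using eqs by simp
    have "v * (c\<^sup>2 + s\<^sup>2) = s * (c * u + s * v) + c * k"
      unfolding k_def by (simp add: power2_eq_square algebra_simps)
    then have v: "v = c * k" using eqs by simp
    show ?thesis using k u v unfolding complex_eq_iff c_def s_def u_def v_def by auto
  qed
  have R_eq: "\<alpha> *\<^sub>R R (Complex x y) = x *\<^sub>R (\<alpha> *\<^sub>R R 1) + y *\<^sub>R (\<alpha> *\<^sub>R R \<i>)" for x y
  proof -
    have "Complex x y = x *\<^sub>R 1 + y *\<^sub>R \<i>" by (simp add: complex_eq_iff)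
    then have "R (Complex x y) = x *\<^sub>R R 1 + y *\<^sub>R R \<i>"
      using lin by (simp add: linear_add linear_scale)
    then show ?thesis by (simp add: scaleR_add_right mult.commute)
  qed
  have "\<Lambda> = gaussian_ideal (a, b)"
    using Ri
  proof
    assume "R \<i> = \<i> * R 1"
    then have i: "\<alpha> *\<^sub>R R \<i> = \<i> * Complex (of_int a) (of_int b)" unfolding ab[symmetric] by simp
    have "\<alpha> *\<^sub>R R (Complex x y) = Complex (of_int a) (of_int b) * Complex x y" for x y
      unfolding R_eq ab i by (simp add: complex_eq_iff algebra_simps)
    then show ?thesis unfolding \<Lambda> gaussian_ideal_def
      by (auto intro!: image_cong elim!: square_lattice_cases)
  next
    \<comment> \<open>The orientation-reversing case: conjugation comes first and permutes the
      lattice, so the image is the same ideal.\<close>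
    assume "R \<i> = - \<i> * R 1"
    then have i: "\<alpha> *\<^sub>R R \<i> = - \<i> * Complex (of_int a) (of_int b)" unfolding ab[symmetric] by simp
    have *: "\<alpha> *\<^sub>R R z = Complex (of_int a) (of_int b) * cnj z" for z
      using R_eq[of "Re z" "Im z"] unfolding ab i complex_surj
      by (simp add: complex_eq_iff algebra_simps)
    have "cnj ` square_lattice = square_lattice"
    proof -
      have "cnj z \<in> square_lattice" if z: "z \<in> square_lattice" for z
      proof -
        obtain x y where "z = Complex (of_int x) (of_int y)"
          using z by (rule square_lattice_cases)
        then have "cnj z = Complex (of_int x) (of_int (- y))" by (simp add: complex_eq_iff)
        then show ?thesis by (metis Complex_of_int_in_square_lattice)
      qed
      moreover from this have "z \<in> cnj ` square_lattice" if "z \<in> square_lattice" for z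
        using that by (intro image_eqI[of _ _ "cnj z"]) auto
      ultimately show ?thesis by blast
    qed
    then show ?thesis unfolding \<Lambda> gaussian_ideal_def *
      by (metis (no_types, lifting) fst_conv snd_conv image_cong image_image)
  qed
  moreover have "(a, b) \<noteq> (0, 0)"
  proof
    assume "(a, b) = (0, 0)"
    then have "\<alpha> *\<^sub>R R 1 = 0" using ab by (simp add: complex_eq_iff)
    then show False using \<alpha> n1 by auto
  qed
  ultimately show "\<exists>p. p \<noteq> (0, 0) \<and> \<Lambda> = gaussian_ideal p" by blast
next
  assume "\<exists>p. p \<noteq> (0, 0) \<and> \<Lambda> = gaussian_ideal p"
  then obtain p where p: "p \<noteq> (0, 0)" and \<Lambda>: "\<Lambda> = gaussian_ideal p" by blast
  define z where "z = Complex (of_int (fst p)) (of_int (snd p))"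
  have z: "z \<noteq> 0" using p unfolding z_def by (cases p) (auto simp: complex_eq_iff)
  have "linear (\<lambda>x. sgn z * x)" by (simp add: linear_iff algebra_simps)
  moreover have "norm (sgn z * x) = norm x" for x using z by (simp add: norm_mult norm_sgn)
  ultimately have "orthogonal_transformation (\<lambda>x. sgn z * x)"
    by (simp add: orthogonal_transformation)
  moreover have "\<Lambda> = (\<lambda>x. norm z *\<^sub>R (sgn z * x)) ` square_lattice"
    unfolding \<Lambda> gaussian_ideal_def z_def[symmetric] using z
    by (simp add: sgn_div_norm)
  ultimately show "similar_sublattice square_lattice \<Lambda>"
    unfolding similar_sublattice_def using z gaussian_ideal_subset \<Lambda>
    by (metis zero_less_norm_iff)
qed

section \<open>Primitivity in terms of the generator\<close>

lemma scaleR_gaussian_ideal: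
  "(\<lambda>x. real m *\<^sub>R x) ` gaussian_ideal (a, b) = gaussian_ideal (int m * a, int m * b)"
  unfolding gaussian_ideal_def image_image
  by (intro image_cong) (auto simp: complex_eq_iff algebra_simps)

text \<open>An integer factor of the whole ideal divides both coordinates of its generator.
  Conversely the gcd of the coordinates can be split off; it is at least 2 if they are not coprime,
  since \<open>p\<close> is nonzero.\<close>

lemma primitive_gaussian_ideal_iff:
  assumes "p \<noteq> (0, 0)"
  shows "primitive_similar_sublattice square_lattice (gaussian_ideal p) \<longleftrightarrow> coprime (fst p) (snd p)"
proof -
  obtain a b where p: "p = (a, b)" by (cases p)
  have "(\<exists>m::nat. m \<ge> 2 \<and> (\<exists>\<Lambda>. similar_sublattice square_lattice \<Lambda> \<and>
          gaussian_ideal p = (\<lambda>x. real m *\<^sub>R x) ` \<Lambda>)) \<longleftrightarrow> \<not> coprime a b"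
  proof
    assume "\<exists>m::nat. m \<ge> 2 \<and> (\<exists>\<Lambda>. similar_sublattice square_lattice \<Lambda> \<and>
          gaussian_ideal p = (\<lambda>x. real m *\<^sub>R x) ` \<Lambda>)"
    then obtain m :: nat and c d where m: "m \<ge> 2" and
      eq: "gaussian_ideal p = gaussian_ideal (int m * c, int m * d)"
      unfolding similar_sublattice_square_lattice_iff
      by (metis scaleR_gaussian_ideal surj_pair)
    have "Complex (of_int a) (of_int b) \<in> gaussian_ideal (int m * c, int m * d)"
      using gaussian_ideal_generator[of p] eq unfolding p by simp
    then obtain x y where "a = int m * c * x - int m * d * y" "b = int m * d * x + int m * c * y"
      unfolding Complex_of_int_in_gaussian_ideal_iff by blast
    then have "int m dvd a" "int m dvd b" by (simp_all add: mult.assoc)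
    then show "\<not> coprime a b" using m coprime_common_divisor_int by fastforce
  next
    assume nc: "\<not> coprime a b"
    define m where "m = nat (gcd a b)"
    have g: "int m = gcd a b" unfolding m_def by simp
    have "int m \<noteq> 0" "int m \<noteq> 1"
      using nc assms unfolding g p by (auto simp: coprime_iff_gcd_eq_1)
    then have m: "m \<ge> 2" by linarith
    obtain c d where cd: "a = int m * c" "b = int m * d"
      unfolding g by (meson dvdE gcd_dvd1 gcd_dvd2)
    then have "(c, d) \<noteq> (0, 0)" using assms p by auto
    then show "\<exists>m::nat. m \<ge> 2 \<and> (\<exists>\<Lambda>. similar_sublattice square_lattice \<Lambda> \<and>
          gaussian_ideal p = (\<lambda>x. real m *\<^sub>R x) ` \<Lambda>)"
      using m scaleR_gaussian_ideal[of m c d] cd unfolding similar_sublattice_square_lattice_iff p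
      by metis
  qed
  moreover have "similar_sublattice square_lattice (gaussian_ideal p)"
    unfolding similar_sublattice_square_lattice_iff using assms by blast
  ultimately show ?thesis unfolding primitive_similar_sublattice_def p by simp
qed

text \<open>Each nonzero ideal has exactly one generator in the quadrant, and its index is the norm
  of that generator; sublattices are thus counted by integer points.\<close>

lemma b_square_eq:
  "b_square n = card {p \<in> quadrant. sq_norm p = int n}"
proof -
  have "{\<Lambda>. similar_sublattice square_lattice \<Lambda> \<and> lattice_index square_lattice \<Lambda> = n}
      = gaussian_ideal ` {p \<in> quadrant. sq_norm p = int n}" (is "?L = ?R")
  proof
    show "?L \<subseteq> ?R"
    proof
      fix \<Lambda> assume *: "\<Lambda> \<in> ?L"
      then obtain p where "p \<in> quadrant" "\<Lambda> = gaussian_ideal p"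
        using gaussian_ideal_in_quadrant unfolding similar_sublattice_square_lattice_iff by blast
      moreover from this have "p \<noteq> (0, 0)" by (auto simp: quadrant_def)
      ultimately show "\<Lambda> \<in> ?R" using * lattice_index_gaussian_ideal[of p] by auto
    qed
    show "?R \<subseteq> ?L"
    proof
      fix \<Lambda> assume "\<Lambda> \<in> ?R"
      then obtain p where p: "p \<in> quadrant" "sq_norm p = int n" "\<Lambda> = gaussian_ideal p" by blast
      then have "p \<noteq> (0, 0)" by (auto simp: quadrant_def)
      then show "\<Lambda> \<in> ?L"
        using p lattice_index_gaussian_ideal[of p] similar_sublattice_square_lattice_iff[of \<Lambda>]
        by (metis (mono_tags, lifting) mem_Collect_eq of_nat_eq_iff)
    qed
  qed
  moreover have "inj_on gaussian_ideal {p \<in> quadrant. sq_norm p = int n}"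
    using inj_on_gaussian_ideal by (rule inj_on_subset) auto
  ultimately show ?thesis unfolding b_square_def by (simp add: card_image)
qed

lemma b_square_pr_eq:
  "b_square_pr n = card {p \<in> quadrant. sq_norm p = int n \<and> coprime (fst p) (snd p)}"
proof -
  have "{\<Lambda>. primitive_similar_sublattice square_lattice \<Lambda> \<and> lattice_index square_lattice \<Lambda> = n}
      = gaussian_ideal ` {p \<in> quadrant. sq_norm p = int n \<and> coprime (fst p) (snd p)}" (is "?L = ?R")
  proof
    show "?L \<subseteq> ?R"
    proof
      fix \<Lambda> assume *: "\<Lambda> \<in> ?L"
      then have "similar_sublattice square_lattice \<Lambda>"
        unfolding primitive_similar_sublattice_def by simp
      then obtain p where "p \<in> quadrant" "\<Lambda> = gaussian_ideal p"
        using gaussian_ideal_in_quadrant unfolding similar_sublattice_square_lattice_iff by blast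
      moreover from this have "p \<noteq> (0, 0)" by (auto simp: quadrant_def)
      ultimately show "\<Lambda> \<in> ?R"
        using * lattice_index_gaussian_ideal[of p] primitive_gaussian_ideal_iff[of p] by auto
    qed
    show "?R \<subseteq> ?L"
    proof
      fix \<Lambda> assume "\<Lambda> \<in> ?R"
      then obtain p where p: "p \<in> quadrant" "sq_norm p = int n" "coprime (fst p) (snd p)"
        "\<Lambda> = gaussian_ideal p" by blast
      then have "p \<noteq> (0, 0)" by (auto simp: quadrant_def)
      then show "\<Lambda> \<in> ?L"
        using p lattice_index_gaussian_ideal[of p] primitive_gaussian_ideal_iff[of p] by auto
    qed
  qed
  moreover have "inj_on gaussian_ideal {p \<in> quadrant. sq_norm p = int n \<and> coprime (fst p) (snd p)}"
    using inj_on_gaussian_ideal by (rule inj_on_subset) auto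
  ultimately show ?thesis unfolding b_square_pr_def by (simp add: card_image)
qed

text \<open>The quarter turn carries the quadrant through three further copies, and these four sets
  partition the plane without the origin.\<close>

lemma card_quarter_turn_invariant:
  assumes "finite S" "(0, 0) \<notin> S" and rot: "\<And>a b. (a, b) \<in> S \<Longrightarrow> (- b, a) \<in> S"
  shows "card S = 4 * card (S \<inter> quadrant)"
proof -
  define T2 T3 T4 where "T2 = {p\<in>S. fst p \<le> 0 \<and> 0 < snd p}" and
    "T3 = {p\<in>S. fst p < 0 \<and> snd p \<le> 0}" and "T4 = {p\<in>S. 0 \<le> fst p \<and> snd p < 0}"
  define r :: "int \<times> int \<Rightarrow> int \<times> int" where "r = (\<lambda>p. (- snd p, fst p))"
  define r' :: "int \<times> int \<Rightarrow> int \<times> int" where "r' = (\<lambda>p. (snd p, - fst p))"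
  \<comment> \<open>Three quarter turns make up the inverse quarter turn.\<close>
  have rot': "(b, - a) \<in> S" if "(a, b) \<in> S" for a b
    using rot[OF rot[OF rot[OF that]]] by simp
  note defs = T2_def T3_def T4_def r_def r'_def quadrant_def
  have "bij_betw r (S \<inter> quadrant) T2" "bij_betw r T2 T3" "bij_betw r T3 T4"
    by (rule bij_betw_byWitness[where f' = r']; auto simp: defs intro: rot rot')+
  then have "card T2 = card (S \<inter> quadrant)" "card T3 = card (S \<inter> quadrant)"
    "card T4 = card (S \<inter> quadrant)"
    by (metis bij_betw_same_card)+
  moreover have "S = (S \<inter> quadrant) \<union> (T2 \<union> (T3 \<union> T4))"
    using \<open>(0, 0) \<notin> S\<close> by (auto simp: defs) (metis linorder_cases order_le_less)+
  moreover have "card ((S \<inter> quadrant) \<union> (T2 \<union> (T3 \<union> T4)))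
      = card (S \<inter> quadrant) + (card T2 + (card T3 + card T4))"
  proof -
    have "finite T2" "finite T3" "finite T4" unfolding defs using \<open>finite S\<close> by auto
    moreover have "(S \<inter> quadrant) \<inter> (T2 \<union> (T3 \<union> T4)) = {}" "T2 \<inter> (T3 \<union> T4) = {}" "T3 \<inter> T4 = {}"
      by (auto simp: defs)
    ultimately show ?thesis using \<open>finite S\<close> by (simp add: card_Un_disjoint)
  qed
  ultimately show ?thesis by simp
qed

section \<open>Lattice points in a disc\<close>

text \<open>\<open>x\<close> is the squared radius. The origin is left out because it generates no
  similar sublattice.\<close>

definition disc_points :: "real \<Rightarrow> (int \<times> int) set" where
  "disc_points x = {p. p \<noteq> (0, 0) \<and> of_int (sq_norm p) \<le> x}"

section \<open>Summatory functions as lattice point counts\<close>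

lemma sq_norm_pos: "p \<noteq> (0, 0) \<Longrightarrow> 0 < sq_norm p"
  by (cases p) (auto simp: sq_norm_def sum_power2_gt_zero_iff)

lemma finite_sq_norm_le: "finite {p. of_int (sq_norm p) \<le> (x::real)}"
proof -
  have "{p. of_int (sq_norm p) \<le> x} \<subseteq> {- \<lfloor>x\<rfloor>..\<lfloor>x\<rfloor>} \<times> {- \<lfloor>x\<rfloor>..\<lfloor>x\<rfloor>}"
  proof
    fix p :: "int \<times> int" assume "p \<in> {p. of_int (sq_norm p) \<le> x}"
    then have *: "(fst p)\<^sup>2 + (snd p)\<^sup>2 \<le> \<lfloor>x\<rfloor>" by (simp add: sq_norm_def le_floor_iff)
    have "\<bar>c\<bar> \<le> c\<^sup>2" for c :: int
      using self_le_power[of "\<bar>c\<bar>" 2] by (cases "c = 0") auto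
    then have "\<bar>fst p\<bar> \<le> (fst p)\<^sup>2" "\<bar>snd p\<bar> \<le> (snd p)\<^sup>2" by auto
    with * have "\<bar>fst p\<bar> \<le> \<lfloor>x\<rfloor>" "\<bar>snd p\<bar> \<le> \<lfloor>x\<rfloor>"
      by (smt (verit) zero_le_power2)+
    then show "p \<in> {- \<lfloor>x\<rfloor>..\<lfloor>x\<rfloor>} \<times> {- \<lfloor>x\<rfloor>..\<lfloor>x\<rfloor>}" by (cases p) auto
  qed
  then show ?thesis by (rule finite_subset) simp
qed

lemma finite_disc_points [simp]: "finite (disc_points x)"
  unfolding disc_points_def by (rule finite_subset[OF _ finite_sq_norm_le[of x]]) auto

text \<open>Norms on \<open>S\<close> are positive integers, the origin being excluded, so a
  summation range starting at 1 meets every fibre.\<close>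

lemma sum_card_sq_norm_fibres:
  assumes "S \<subseteq> disc_points x"
  shows "(\<Sum>n | 1 \<le> n \<and> real n \<le> x. card {p \<in> S. sq_norm p = int n}) = card S"
proof -
  have fin: "finite S" using assms finite_subset finite_disc_points by blast
  have finN: "finite {n. 1 \<le> n \<and> real n \<le> x}"
    by (rule finite_subset[of _ "{..nat \<lfloor>x\<rfloor>}"]) (auto simp: le_nat_floor)
  have sub: "(\<lambda>p. nat (sq_norm p)) ` S \<subseteq> {n. 1 \<le> n \<and> real n \<le> x}"
  proof clarify
    fix a b assume "(a, b) \<in> S"
    then have "(a, b) \<noteq> (0, 0)" "of_int (sq_norm (a, b)) \<le> x"
      using assms unfolding disc_points_def by auto
    then show "1 \<le> nat (sq_norm (a, b)) \<and> real (nat (sq_norm (a, b))) \<le> x"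
      using sq_norm_pos[of "(a, b)"] by simp
  qed
  have "{p \<in> S. sq_norm p = int n} = {p \<in> S. nat (sq_norm p) = n}" for n
    by (auto simp: sq_norm_def)
  then show ?thesis using sum.group[OF fin finN sub, of "\<lambda>_. 1::nat"] by simp
qed

text \<open>The factor 4 is the number of generators of an ideal, one in each rotated
  quadrant.\<close>

lemma sum_b_square:
  "4 * (\<Sum>n | 1 \<le> n \<and> real n \<le> x. real (b_square n)) = real (card (disc_points x))"
proof -
  have "card (disc_points x) = 4 * card (disc_points x \<inter> quadrant)"
    by (rule card_quarter_turn_invariant, simp)
       (auto simp: disc_points_def sq_norm_def add.commute)
  also have "card (disc_points x \<inter> quadrant)
      = (\<Sum>n | 1 \<le> n \<and> real n \<le> x. card {p \<in> disc_points x \<inter> quadrant. sq_norm p = int n})"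
    by (rule sum_card_sq_norm_fibres[symmetric]) auto
  also have "\<dots> = (\<Sum>n | 1 \<le> n \<and> real n \<le> x. b_square n)"
    unfolding b_square_eq
    by (intro sum.cong arg_cong[of _ _ card]) (auto simp: disc_points_def quadrant_def)
  finally show ?thesis by simp
qed

text \<open>A quarter turn swaps the coordinates up to sign, so it preserves coprimality and the
  factor 4 arises as before.\<close>

lemma sum_b_square_pr:
  "4 * (\<Sum>n | 1 \<le> n \<and> real n \<le> x. real (b_square_pr n))
     = real (card {p \<in> disc_points x. coprime (fst p) (snd p)})"
proof -
  let ?S = "{p \<in> disc_points x. coprime (fst p) (snd p)}"
  have "card ?S = 4 * card (?S \<inter> quadrant)"
    by (rule card_quarter_turn_invariant, simp)
       (auto simp: disc_points_def sq_norm_def add.commute coprime_commute)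
  also have "card (?S \<inter> quadrant)
      = (\<Sum>n | 1 \<le> n \<and> real n \<le> x. card {p \<in> ?S \<inter> quadrant. sq_norm p = int n})"
    by (rule sum_card_sq_norm_fibres[symmetric]) auto
  also have "\<dots> = (\<Sum>n | 1 \<le> n \<and> real n \<le> x. b_square_pr n)"
    unfolding b_square_pr_eq
    by (intro sum.cong arg_cong[of _ _ card]) (auto simp: disc_points_def quadrant_def)
  finally show ?thesis by simp
qed

section \<open>Comparison of the point count with the area\<close>

lemma measure_lborel_cball_complex:
  "0 \<le> r \<Longrightarrow> measure lborel (cball (c::complex) r) = pi * r\<^sup>2"
  by (simp add: content_cball unit_ball_vol_2)

lemma measure_lborel_unit_square:
  fixes a b :: real
  shows "measure lborel (box (Complex a b) (Complex (a + 1) (b + 1))) = 1"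
    "measure lborel (cbox (Complex a b) (Complex (a + 1) (b + 1))) = 1"
  by (simp_all add: measure_lborel_box_eq measure_lborel_cbox_eq Basis_complex_def)

lemma mem_cbox_Complex:
  "z \<in> cbox (Complex a b) (Complex c d) \<longleftrightarrow> a \<le> Re z \<and> Re z \<le> c \<and> b \<le> Im z \<and> Im z \<le> d"
  by (auto simp: mem_box Basis_complex_def)

lemma mem_box_Complex:
  "z \<in> box (Complex a b) (Complex c d) \<longleftrightarrow> a < Re z \<and> Re z < c \<and> b < Im z \<and> Im z < d"
  by (auto simp: mem_box Basis_complex_def)

text \<open>The bound 2 comes from the 1-norm; it is cruder than the diameter \<open>sqrt 2\<close>
  but does not affect the order of the error.\<close>

lemma norm_diff_unit_square_le:
  assumes "a \<le> Re z" "Re z \<le> a + 1" "b \<le> Im z" "Im z \<le> b + 1"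
  shows "norm (z - Complex a b) \<le> 2"
proof -
  have "norm (z - Complex a b) \<le> \<bar>Re (z - Complex a b)\<bar> + \<bar>Im (z - Complex a b)\<bar>"
    by (rule cmod_le)
  also have "\<dots> \<le> 2" using assms by simp
  finally show ?thesis .
qed

lemma sq_norm_le_iff:
  assumes "0 \<le> r"
  shows "of_int (sq_norm (a, b)) \<le> r\<^sup>2 \<longleftrightarrow> norm (Complex (of_int a) (of_int b)) \<le> r"
  using assms by (simp add: sq_norm_def cmod_def real_sqrt_le_iff' sqrt_le_D real_le_lsqrt)

text \<open>Each point is the lower left corner of a unit square; these squares are disjoint and
  stay within the disc of radius \<open>r + 2\<close>, so their total area is bounded by its
  area.\<close>

lemma card_lattice_points_le:
  assumes "0 \<le> r"
  shows "real (card {p. of_int (sq_norm p) \<le> r\<^sup>2}) \<le> pi * (r + 2)\<^sup>2"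
proof -
  define P where "P = {p. of_int (sq_norm p) \<le> r\<^sup>2}"
  \<comment> \<open>Open squares, so that neighbours are disjoint.\<close>
  define F where "F = (\<lambda>(a::int, b::int). box (Complex (of_int a) (of_int b)) (Complex (of_int a + 1) (of_int b + 1)))"
  have fin: "finite P" unfolding P_def by (rule finite_sq_norm_le)
  have "disjoint_family_on F P"
  proof -
    have "a = c \<and> b = d" if "z \<in> F (a, b)" "z \<in> F (c, d)" for a b c d z
    proof -
      have "of_int a < Re z" "Re z < of_int c + 1" "of_int c < Re z" "Re z < of_int a + 1"
        "of_int b < Im z" "Im z < of_int d + 1" "of_int d < Im z" "Im z < of_int b + 1"
        using that unfolding F_def by (auto simp: mem_box_Complex)
      then show ?thesis by linarith
    qed
    then show ?thesis unfolding disjoint_family_on_def by fast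
  qed
  moreover have "emeasure lborel (F p) \<noteq> \<infinity>" for p
    unfolding F_def using emeasure_lborel_box_finite by (cases p) (simp add: less_top[symmetric])
  ultimately have "measure lborel (\<Union>p\<in>P. F p) = (\<Sum>p\<in>P. measure lborel (F p))"
    using fin by (intro measure_finite_Union) (auto simp: F_def)
  also have "\<dots> = (\<Sum>p\<in>P. 1)"
    by (intro sum.cong) (auto simp: F_def measure_lborel_unit_square)
  finally have "real (card P) = measure lborel (\<Union>p\<in>P. F p)" by simp
  also have "\<dots> \<le> measure lborel (cball (0::complex) (r + 2))"
  proof (rule measure_mono_fmeasurable)
    show "(\<Union>p\<in>P. F p) \<subseteq> cball 0 (r + 2)"
    proof clarify
      fix z a b assume p: "(a, b) \<in> P" and z: "z \<in> F (a, b)"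
      have "norm (Complex (of_int a) (of_int b)) \<le> r"
        using p assms sq_norm_le_iff unfolding P_def by blast
      moreover have "norm (z - Complex (of_int a) (of_int b)) \<le> 2"
        using z unfolding F_def by (intro norm_diff_unit_square_le) (auto simp: mem_box_Complex)
      ultimately have "norm z \<le> r + 2"
        using norm_triangle_ineq[of "z - Complex (of_int a) (of_int b)" "Complex (of_int a) (of_int b)"]
        by simp
      then show "z \<in> cball 0 (r + 2)" by simp
    qed
    show "(\<Union>p\<in>P. F p) \<in> sets lborel"
      using fin by (auto simp: F_def intro!: sets.finite_UN)
    show "cball 0 (r + 2) \<in> fmeasurable lborel" by (rule fmeasurable_compact) simp
  qed
  also have "\<dots> = pi * (r + 2)\<^sup>2" using assms by (simp add: measure_lborel_cball_complex)
  finally show ?thesis unfolding P_def .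
qed

text \<open>Rounding both coordinates down moves a point by at most 2, so the unit squares attached
  to the points of the disc of radius \<open>r\<close> cover the disc of radius
  \<open>r - 2\<close>.\<close>

lemma card_lattice_points_ge:
  assumes "2 \<le> r"
  shows "pi * (r - 2)\<^sup>2 \<le> real (card {p. of_int (sq_norm p) \<le> r\<^sup>2})"
proof -
  define P where "P = {p. of_int (sq_norm p) \<le> r\<^sup>2}"
  \<comment> \<open>Closed squares, so that they cover; overlaps are harmless because only
    subadditivity of the measure is applied.\<close>
  define F where "F = (\<lambda>(a::int, b::int). cbox (Complex (of_int a) (of_int b)) (Complex (of_int a + 1) (of_int b + 1)))"
  have fin: "finite P" unfolding P_def by (rule finite_sq_norm_le)
  have "pi * (r - 2)\<^sup>2 = measure lborel (cball (0::complex) (r - 2))"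
    using assms by (simp add: measure_lborel_cball_complex)
  also have "\<dots> \<le> measure lborel (\<Union>p\<in>P. F p)"
  proof (rule measure_mono_fmeasurable)
    show "cball 0 (r - 2) \<subseteq> (\<Union>p\<in>P. F p)"
    proof
      fix z :: complex assume "z \<in> cball 0 (r - 2)"
      then have z: "norm z \<le> r - 2" by simp
      define a b where "a = \<lfloor>Re z\<rfloor>" and "b = \<lfloor>Im z\<rfloor>"
      have zF: "of_int a \<le> Re z" "Re z \<le> of_int a + 1" "of_int b \<le> Im z" "Im z \<le> of_int b + 1"
        unfolding a_def b_def by linarith+
      then have "norm (z - Complex (of_int a) (of_int b)) \<le> 2" by (rule norm_diff_unit_square_le)
      then have "norm (Complex (of_int a) (of_int b)) \<le> r"
        using norm_triangle_ineq4[of z "z - Complex (of_int a) (of_int b)"] z by simp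
      then have "(a, b) \<in> P" using assms unfolding P_def by (simp add: sq_norm_le_iff)
      moreover have "z \<in> F (a, b)" using zF unfolding F_def by (simp add: mem_cbox_Complex)
      ultimately show "z \<in> (\<Union>p\<in>P. F p)" by blast
    qed
    show "(\<Union>p\<in>P. F p) \<in> fmeasurable lborel"
      using fin by (auto simp: F_def intro!: fmeasurable.finite_UN)
  qed simp
  also have "\<dots> \<le> (\<Sum>p\<in>P. measure lborel (F p))"
    using fin by (intro measure_UNION_le) (auto simp: F_def)
  also have "\<dots> = (\<Sum>p\<in>P. 1)"
    by (intro sum.cong) (auto simp: F_def measure_lborel_unit_square)
  finally show ?thesis unfolding P_def by simp
qed

text \<open>With r = \<open>sqrt x\<close> at least 1, changing the radius by 2 changes the area by
  at most 32 r; the missing origin costs 1, at most another r.\<close>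

lemma card_disc_points_bound:
  assumes "1 \<le> x"
  shows "\<bar>real (card (disc_points x)) - pi * x\<bar> \<le> 33 * sqrt x"
proof -
  define r where "r = sqrt x"
  have r: "1 \<le> r" "x = r\<^sup>2" using assms unfolding r_def by auto
  define N where "N = real (card {p. of_int (sq_norm p) \<le> r\<^sup>2})"
  have "{p. of_int (sq_norm p) \<le> r\<^sup>2} = insert (0, 0) (disc_points x)"
    unfolding disc_points_def r by (auto simp: sq_norm_def)
  moreover have "(0, 0) \<notin> disc_points x" unfolding disc_points_def by simp
  ultimately have N: "N = real (card (disc_points x)) + 1"
    unfolding N_def by simp
  have "N \<le> pi * (r + 2)\<^sup>2" unfolding N_def using r by (intro card_lattice_points_le) simp
  also have "\<dots> = pi * r\<^sup>2 + pi * (4 * r + 4)" by (simp add: power2_eq_square algebra_simps)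
  also have "pi * (4 * r + 4) \<le> 4 * (8 * r)"
    using r pi_less_4 by (intro mult_mono) auto
  finally have up: "N \<le> pi * r\<^sup>2 + 32 * r" by simp
  have low: "pi * r\<^sup>2 - 32 * r \<le> N"
  proof (cases "2 \<le> r")
    case True
    have "pi * r \<le> 4 * r" using r pi_less_4 by (intro mult_right_mono) auto
    then have "pi * r\<^sup>2 - 32 * r \<le> pi * r\<^sup>2 - 4 * (pi * r)" using r by linarith
    also have "\<dots> \<le> pi * (r - 2)\<^sup>2" by (simp add: power2_eq_square algebra_simps)
    also have "\<dots> \<le> N" unfolding N_def using True by (rule card_lattice_points_ge)
    finally show ?thesis .
  next
    case False
    have "pi * r\<^sup>2 \<le> 4 * (2 * r)"
      using r pi_less_4 False by (intro mult_mono) (auto simp: power2_eq_square)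
    also have "\<dots> \<le> 32 * r" using r by simp
    finally have "pi * r\<^sup>2 - 32 * r \<le> 0" by simp
    also have "0 \<le> N" unfolding N_def by simp
    finally show ?thesis .
  qed
  show ?thesis using up low N r unfolding r_def[symmetric] by (auto simp: abs_le_iff)
qed

section \<open>The Moebius function and the constants\<close>

definition moebius_mu :: "nat \<Rightarrow> real" where
  "moebius_mu n = (if squarefree n then (-1) ^ card (prime_factors n) else 0)"

lemma abs_moebius_mu_le_1: "\<bar>moebius_mu n\<bar> \<le> 1"
  by (simp add: moebius_mu_def power_abs)

lemma moebius_mu_prime_mult:
  assumes p: "prime p" and d: "\<not> p dvd d" and sf: "squarefree d"
  shows "moebius_mu (p * d) = - moebius_mu d"
proof -
  have d0: "d \<noteq> 0" using d by (metis dvd_0_right)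
  have "coprime p d" using p d by (rule prime_imp_coprime)
  then have "squarefree (p * d)"
    using squarefree_mult_coprime squarefree_prime p sf by blast
  moreover have "prime_factors (p * d) = insert p (prime_factors d)"
    using p d0 by (simp add: prime_factorization_mult prime_factorization_prime)
  moreover have "p \<notin> prime_factors d" using d by auto
  ultimately show ?thesis using sf by (simp add: moebius_mu_def)
qed

text \<open>Fix a prime p dividing n > 1. Its squarefree divisors pair off as d and p d with d prime
  to p, and the two values cancel.\<close>

lemma sum_moebius_mu_divisors:
  assumes "n > 0"
  shows "(\<Sum>d | d dvd n. moebius_mu d) = (if n = 1 then 1 else 0)"
proof (cases "n = 1")
  case True
  then show ?thesis by (simp add: moebius_mu_def)
next
  case False
  then obtain p where p: "prime p" "p dvd n" by (metis prime_factor_nat)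
  define A where "A = {d. d dvd n \<and> squarefree d \<and> \<not> p dvd d}"
  have fin: "finite {d. d dvd n}" using assms by simp
  have finA: "finite A" unfolding A_def by (rule finite_subset[OF _ fin]) auto
  have p0: "p > 0" using p by (simp add: prime_gt_0_nat)
  have "(\<Sum>d | d dvd n. moebius_mu d) = (\<Sum>d | d dvd n \<and> squarefree d. moebius_mu d)"
    by (rule sum.mono_neutral_right[OF fin]) (auto simp: moebius_mu_def)
  also have "{d. d dvd n \<and> squarefree d} = A \<union> (\<lambda>d. p * d) ` A"
  proof (intro set_eqI iffI)
    fix d assume d: "d \<in> {d. d dvd n \<and> squarefree d}"
    show "d \<in> A \<union> (\<lambda>d. p * d) ` A"
    proof (cases "p dvd d")
      case True
      then obtain e where e: "d = p * e" by blast
      have "\<not> p dvd e"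
      proof
        assume "p dvd e"
        then have "p\<^sup>2 dvd d" unfolding e by (simp add: power2_eq_square)
        then have "p dvd 1" using d by (intro squarefreeD[of d]) auto
        then show False using p(1) by (simp add: prime_nat_iff)
      qed
      moreover have "e dvd n" using d e by (auto dest: dvd_mult_right)
      moreover have "squarefree e" using d e squarefree_mono[of e d] by simp
      ultimately show ?thesis unfolding A_def e by blast
    qed (use d in \<open>simp add: A_def\<close>)
  next
    fix d assume "d \<in> A \<union> (\<lambda>d. p * d) ` A"
    then show "d \<in> {d. d dvd n \<and> squarefree d}"
    proof
      assume "d \<in> (\<lambda>d. p * d) ` A"
      then obtain e where e: "d = p * e" "e dvd n" "squarefree e" "\<not> p dvd e"
        unfolding A_def by auto
      have cop: "coprime p e" using p(1) e(4) by (rule prime_imp_coprime)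
      then have "squarefree d"
        unfolding e using squarefree_mult_coprime squarefree_prime p e by blast
      moreover have "d dvd n" unfolding e using cop p e by (simp add: divides_mult)
      ultimately show ?thesis by simp
    qed (simp add: A_def)
  qed
  also have "(\<Sum>d\<in>A \<union> (\<lambda>d. p * d) ` A. moebius_mu d)
      = (\<Sum>d\<in>A. moebius_mu d) + (\<Sum>d\<in>(\<lambda>d. p * d) ` A. moebius_mu d)"
    by (rule sum.union_disjoint) (use finA in \<open>auto simp: A_def\<close>)
  also have "(\<Sum>d\<in>(\<lambda>d. p * d) ` A. moebius_mu d) = (\<Sum>d\<in>A. moebius_mu (p * d))"
    using p0 by (subst sum.reindex) (auto simp: inj_on_def)
  also have "\<dots> = (\<Sum>d\<in>A. - moebius_mu d)"
    using p by (intro sum.cong) (auto simp: A_def moebius_mu_prime_mult)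
  finally show ?thesis using False by (simp add: sum_negf)
qed

text \<open>The Basel sum as an unordered sum, the form in which a double series may be
  regrouped.\<close>

lemma has_sum_inverse_squares: "((\<lambda>n. 1 / real n ^ 2) has_sum (pi\<^sup>2 / 6)) {0<..}"
proof -
  have "((\<lambda>n. 1 / real (Suc n) ^ 2) has_sum (pi\<^sup>2 / 6)) UNIV"
    using inverse_squares_sums by (intro sums_nonneg_imp_has_sum) (auto simp: add.commute)
  then have "((\<lambda>n. 1 / real n ^ 2) has_sum (pi\<^sup>2 / 6)) (range Suc)"
    by (subst has_sum_reindex) (auto simp: o_def)
  moreover have "range Suc = {0<..}"
    by (auto simp: greaterThan_def image_iff gr0_conv_Suc)
  ultimately show ?thesis by simp
qed

text \<open>The product of this series with the Basel series is a double sum over (d, m). Regrouped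
  by n = d m, its inner sums are divisor sums of the Moebius function and vanish except at n = 1, so
  the product is 1.\<close>

lemma has_sum_moebius_mu: "((\<lambda>n. moebius_mu n / real n ^ 2) has_sum (6 / pi\<^sup>2)) {0<..}"
proof -
  define f g :: "nat \<Rightarrow> real" where "f = (\<lambda>n. moebius_mu n / real n ^ 2)" and "g = (\<lambda>n. 1 / real n ^ 2)"
  have g: "(g has_sum (pi\<^sup>2 / 6)) {0<..}" unfolding g_def by (rule has_sum_inverse_squares)
  have g_abs: "(\<lambda>n. norm (g n)) summable_on {0<..}"
    using has_sum_imp_summable[OF g] by (simp add: g_def)
  have f_abs: "(\<lambda>n. norm (f n)) summable_on {0<..}"
    by (rule Infinite_Sum.abs_summable_on_comparison_test[OF g_abs])
       (auto simp: f_def g_def abs_mult divide_right_mono abs_moebius_mu_le_1)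
  define F where "F = (\<lambda>(d, m). f d * g m)"
  \<comment> \<open>Absolute summability, from which both orders of summation are justified.\<close>
  have "(\<lambda>p. norm (F p)) summable_on {0<..} \<times> {0<..}"
    unfolding Infinite_Sum.abs_summable_on_Sigma_iff
  proof (intro conjI ballI)
    show "(\<lambda>m. norm (F (d, m))) summable_on {0<..}" for d
      using summable_on_cmult_right[OF g_abs, of "\<bar>f d\<bar>"] by (simp add: F_def abs_mult)
    have "(\<Sum>\<^sub>\<infinity>m\<in>{0<..}. norm (F (d, m))) = norm (f d) * (pi\<^sup>2 / 6)" for d
      using has_sum_cmult_right[OF g, of "\<bar>f d\<bar>"]
      by (intro infsumI) (simp add: F_def abs_mult g_def)
    then have "(\<lambda>d. norm (\<Sum>\<^sub>\<infinity>m\<in>{0<..}. norm (F (d, m)))) = (\<lambda>d. norm (f d) * (pi\<^sup>2 / 6))"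
      by (simp only:) simp
    then show "(\<lambda>d. norm (\<Sum>\<^sub>\<infinity>m\<in>{0<..}. norm (F (d, m)))) summable_on {0<..}"
      using summable_on_cmult_left[OF f_abs, of "pi\<^sup>2 / 6"] by (simp only:)
  qed
  then have "F summable_on {0<..} \<times> {0<..}" by (rule abs_summable_summable)
  then obtain S where S: "(F has_sum S) ({0<..} \<times> {0<..})" by (auto simp: summable_on_def)
  have "f summable_on {0<..}" using f_abs by (rule abs_summable_summable)
  then obtain c where c: "(f has_sum c) {0<..}" by (auto simp: summable_on_def)
  \<comment> \<open>First evaluation: sum over m for fixed d.\<close>
  have "((\<lambda>d. f d * (pi\<^sup>2 / 6)) has_sum S) {0<..}"
    by (rule has_sum_SigmaD[OF S]) (use has_sum_cmult_right[OF g] in \<open>simp add: F_def\<close>)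
  moreover have "((\<lambda>d. f d * (pi\<^sup>2 / 6)) has_sum (c * (pi\<^sup>2 / 6))) {0<..}"
    using c by (rule has_sum_cmult_left)
  ultimately have S1: "S = c * (pi\<^sup>2 / 6)" by (rule has_sum_unique)
  \<comment> \<open>Second evaluation: \<open>h\<close> indexes the pairs (d, m) by their product n
    and the divisor d.\<close>
  define h :: "nat \<times> nat \<Rightarrow> nat \<times> nat" where "h = (\<lambda>(n, d). (d, n div d))"
  have "bij_betw h (SIGMA n:{0<..}. {d. d dvd n}) ({0<..} \<times> {0<..})"
    by (rule bij_betw_byWitness[where f' = "\<lambda>(d, m). (d * m, d)"])
       (auto simp: h_def dvd_div_eq_0_iff intro: Nat.gr0I)
  then have "((F \<circ> h) has_sum S) (SIGMA n:{0<..}. {d. d dvd n})"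
    using S has_sum_reindex_bij_betw[of h _ _ F S] by (simp add: o_def)
  then have "((\<lambda>n. if n = 1 then 1 else 0) has_sum S) {0::nat<..}"
  proof (rule has_sum_SigmaD)
    fix n :: nat assume n: "n \<in> {0<..}"
    have "(F \<circ> h) (n, d) = moebius_mu d * (1 / real n ^ 2)" if "d dvd n" for d
      using that n unfolding F_def h_def f_def g_def
      by (auto simp: real_of_nat_div field_simps)
    then have "(\<Sum>d | d dvd n. (F \<circ> h) (n, d)) = (\<Sum>d | d dvd n. moebius_mu d * (1 / real n ^ 2))"
      by (intro sum.cong) auto
    also have "\<dots> = (if n = 1 then 1 else 0)"
      using n sum_moebius_mu_divisors[of n] unfolding sum_distrib_right[symmetric] by simp
    finally show "((\<lambda>d. (F \<circ> h) (n, d)) has_sum (if n = 1 then 1 else 0)) {d. d dvd n}"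
      using n by (intro has_sum_finiteI) auto
  qed
  moreover have "((\<lambda>n. if n = 1 then 1 else 0 :: real) has_sum 1) {0::nat<..}"
    by (rule has_sum_finite_neutralI[of "{1}"]) auto
  ultimately have "S = 1" by (rule has_sum_unique)
  with S1 have "c = 6 / pi\<^sup>2" by (simp add: field_simps)
  with c show ?thesis unfolding f_def by simp
qed

text \<open>Telescoping: the square in each denominator is replaced by the product with the
  preceding integer.\<close>

lemma sum_inverse_squares_le:
  assumes "0 < N" "N \<le> M"
  shows "(\<Sum>n\<in>{N<..M}. 1 / real n ^ 2) \<le> 1 / N - 1 / M"
  using assms(2)
proof (induction rule: dec_induct)
  case (step M)
  have "{N<..Suc M} = insert (Suc M) {N<..M}" using step by auto
  then have "(\<Sum>n\<in>{N<..Suc M}. 1 / real n ^ 2) \<le> 1 / real (Suc M) ^ 2 + (1 / N - 1 / M)"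
    using step by simp
  also have "1 / real (Suc M) ^ 2 \<le> 1 / M - 1 / Suc M"
  proof -
    have "1 / real (Suc M) ^ 2 \<le> 1 / (real M * real (Suc M))"
      using step assms(1) by (intro divide_left_mono) (auto simp: power2_eq_square)
    also have "\<dots> = 1 / M - 1 / Suc M" using step assms(1) by (simp add: field_simps)
    finally show ?thesis .
  qed
  finally show ?case by simp
qed simp

text \<open>The bound holds uniformly for the difference to every longer partial sum, hence also in
  the limit.\<close>

lemma sum_moebius_mu_tail:
  assumes "0 < N"
  shows "\<bar>(\<Sum>n=1..N. moebius_mu n / real n ^ 2) - 6 / pi\<^sup>2\<bar> \<le> 1 / N"
proof -
  let ?f = "\<lambda>n. moebius_mu n / real n ^ 2"
  \<comment> \<open>Index 0 may be added, since division by zero makes its term 0.\<close>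
  have "(?f has_sum (6 / pi\<^sup>2)) UNIV"
    using has_sum_moebius_mu by (subst has_sum_cong_neutral[of "{0<..}" UNIV]) auto
  then have "?f sums (6 / pi\<^sup>2)" by (rule has_sum_imp_sums)
  then have lim: "(\<lambda>M. \<Sum>n\<le>M. ?f n) \<longlonglongrightarrow> 6 / pi\<^sup>2"
    by (simp add: sums_def_le)
  have *: "\<bar>(\<Sum>n=1..N. ?f n) - (\<Sum>n\<le>M. ?f n)\<bar> \<le> 1 / N" if "M \<ge> N" for M
  proof -
    have "{..M} = insert 0 ({1..N} \<union> {N<..M})" using that by auto
    then have "(\<Sum>n\<le>M. ?f n) = (\<Sum>n=1..N. ?f n) + (\<Sum>n\<in>{N<..M}. ?f n)"
      by (simp, subst sum.union_disjoint) auto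
    then have "\<bar>(\<Sum>n=1..N. ?f n) - (\<Sum>n\<le>M. ?f n)\<bar> = \<bar>\<Sum>n\<in>{N<..M}. ?f n\<bar>" by simp
    also have "\<dots> \<le> (\<Sum>n\<in>{N<..M}. \<bar>?f n\<bar>)" by (rule sum_abs)
    also have "\<dots> \<le> (\<Sum>n\<in>{N<..M}. 1 / real n ^ 2)"
      by (intro sum_mono) (simp add: divide_right_mono abs_moebius_mu_le_1)
    also have "\<dots> \<le> 1 / N - 1 / M" using assms that by (rule sum_inverse_squares_le)
    also have "\<dots> \<le> 1 / N" by simp
    finally show ?thesis .
  qed
  show ?thesis
  proof (rule tendsto_upperbound)
    show "(\<lambda>M. \<bar>(\<Sum>n=1..N. ?f n) - (\<Sum>n\<le>M. ?f n)\<bar>) \<longlonglongrightarrow> \<bar>(\<Sum>n=1..N. ?f n) - 6 / pi\<^sup>2\<bar>"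
      by (intro tendsto_intros lim)
    show "\<forall>\<^sub>F M in sequentially. \<bar>(\<Sum>n=1..N. ?f n) - (\<Sum>n\<le>M. ?f n)\<bar> \<le> 1 / N"
      using eventually_ge_at_top[of N] by (rule eventually_mono) (rule *)
  qed simp
qed

text \<open>Leibniz's series, with zero terms inserted for the even integers.\<close>

lemma dirichlet_L_chi_minus4: "dirichlet_L chi_minus4 1 = pi / 4"
proof -
  let ?f = "\<lambda>n. chi_minus4 (Suc n) * real (Suc n) powr - 1"
  have "summable (\<lambda>k. (-1) ^ k * (1 / real (k * 2 + 1) * 1 ^ (k * 2 + 1)))"
    by (rule summable_arctan_series) simp
  then have "(\<lambda>k. (-1) ^ k * 1 / real (k * 2 + 1)) sums (pi / 4)"
    unfolding pi_series by (simp add: summable_sums)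
  \<comment> \<open>The series is indexed from 0 but starts at the integer 1, so the odd integer 2k
    + 1 sits at the even index 2k.\<close>
  moreover have "(-1) ^ k * 1 / real (k * 2 + 1) = ?f (2 * k)" for k
  proof -
    have "Suc (2 * k) mod 4 = 1 \<longleftrightarrow> even k" by presburger
    then show ?thesis
      by (simp add: chi_minus4_def powr_minus_divide mult.commute)
  qed
  ultimately have "(\<lambda>k. ?f (2 * k)) sums (pi / 4)" by simp
  then have "?f sums (pi / 4)"
    by (subst (asm) sums_mono_reindex) (auto simp: strict_mono_def chi_minus4_def image_iff elim!: evenE)
  then show ?thesis unfolding dirichlet_L_def by (rule sums_unique[symmetric])
qed

lemma riemann_zeta_2: "riemann_zeta 2 = pi\<^sup>2 / 6"
proof -
  have "(\<lambda>n. real (Suc n) powr - 2) = (\<lambda>n. 1 / (real n + 1)\<^sup>2)"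
    by (simp add: fun_eq_iff powr_minus_divide powr_numeral add.commute)
  then show ?thesis
    unfolding riemann_zeta_def using inverse_squares_sums by (simp add: sums_iff add.commute)
qed

text \<open>The sequence \<open>harm n - ln n\<close> is decreasing and equals 1 at n = 1.\<close>

lemma harm_le_1_plus_ln: "0 < n \<Longrightarrow> harm n \<le> 1 + ln (real n)"
  using euler_mascheroni_sequence_decreasing[of 1 n] by (simp add: harm_expand)

section \<open>Coprime lattice points in a disc\<close>

text \<open>Dividing the point by d leaves a nonzero lattice point, whose norm is at least 1. This
  makes the Moebius sum finite.\<close>

lemma common_divisor_le_sqrt:
  assumes "p \<in> disc_points x" "d > 0" "int d dvd fst p" "int d dvd snd p"
  shows "real d \<le> sqrt x"
proof -
  obtain a b where p: "p = (int d * a, int d * b)"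
    using assms(3,4) by (metis dvdE prod.collapse)
  have "(a, b) \<noteq> (0, 0)" using assms(1) unfolding p disc_points_def by auto
  then have "1 \<le> sq_norm (a, b)" using sq_norm_pos[of "(a, b)"] by simp
  then have "int d ^ 2 * 1 \<le> int d ^ 2 * sq_norm (a, b)" by (intro mult_left_mono) auto
  also have "\<dots> = sq_norm p" unfolding p by (simp add: sq_norm_def algebra_simps)
  finally have "real_of_int (int d ^ 2) \<le> real_of_int (sq_norm p)" by (simp only: of_int_le_iff mult_1_right)
  also have "\<dots> \<le> x" using assms(1) unfolding disc_points_def by simp
  finally have "real d ^ 2 \<le> x" by simp
  then show ?thesis by (rule real_le_rsqrt)
qed

text \<open>Division by d shrinks the radius by d, hence the squared radius by d^2.\<close>

lemma card_disc_points_multiples: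
  assumes "d > 0"
  shows "card {p \<in> disc_points x. int d dvd fst p \<and> int d dvd snd p} = card (disc_points (x / real d ^ 2))"
proof -
  let ?h = "\<lambda>p. (int d * fst p, int d * snd p)"
  have norm: "of_int (sq_norm (?h p)) \<le> x \<longleftrightarrow> of_int (sq_norm p) \<le> x / real d ^ 2" for p
  proof -
    have "real_of_int (sq_norm (?h p)) = real d ^ 2 * of_int (sq_norm p)"
      by (simp add: sq_norm_def algebra_simps)
    then show ?thesis using assms by (simp add: field_simps)
  qed
  have "{p \<in> disc_points x. int d dvd fst p \<and> int d dvd snd p} = ?h ` disc_points (x / real d ^ 2)"
  proof (intro set_eqI iffI)
    fix p assume p: "p \<in> {p \<in> disc_points x. int d dvd fst p \<and> int d dvd snd p}"
    then obtain a b where ab: "p = (int d * a, int d * b)"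
      by (metis (mono_tags, lifting) dvdE mem_Collect_eq prod.collapse)
    then have "(a, b) \<in> disc_points (x / real d ^ 2)"
      using p norm[of "(a, b)"] by (auto simp: disc_points_def)
    then show "p \<in> ?h ` disc_points (x / real d ^ 2)" using ab by force
  next
    fix p assume "p \<in> ?h ` disc_points (x / real d ^ 2)"
    then obtain q where p: "p = ?h q" and "q \<in> disc_points (x / real d ^ 2)" by blast
    then show "p \<in> {p \<in> disc_points x. int d dvd fst p \<and> int d dvd snd p}"
      using norm[of q] assms unfolding p by (cases q) (auto simp: disc_points_def)
  qed
  moreover have "inj_on ?h (disc_points (x / real d ^ 2))"
    using assms by (auto simp: inj_on_def prod_eq_iff)
  ultimately show ?thesis by (simp add: card_image)
qed

text \<open>Coprimality is detected by the divisor sum of the Moebius function at the gcd;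
  exchanging the sums then counts, for each d, the points divisible by d.\<close>

lemma card_coprime_disc_points:
  fixes x :: real
  defines "N \<equiv> nat \<lfloor>sqrt x\<rfloor>"
  shows "real (card {p \<in> disc_points x. coprime (fst p) (snd p)})
     = (\<Sum>d=1..N. moebius_mu d * real (card (disc_points (x / real d ^ 2))))"
proof -
  \<comment> \<open>The gcd is nonzero away from the origin, so its divisors are positive, and they
    do not exceed \<open>sqrt x\<close>.\<close>
  have dvds: "{d. d dvd nat (gcd (fst p) (snd p))} = {d\<in>{1..N}. int d dvd fst p \<and> int d dvd snd p}"
    if p: "p \<in> disc_points x" for p
  proof (intro set_eqI iffI)
    have g: "gcd (fst p) (snd p) \<noteq> 0" using p by (auto simp: disc_points_def prod_eq_iff)
    fix d assume "d \<in> {d. d dvd nat (gcd (fst p) (snd p))}"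
    then have d: "d dvd nat (gcd (fst p) (snd p))" by simp
    then have "int d dvd gcd (fst p) (snd p)"
      using dvd_nat_abs_iff[of d "gcd (fst p) (snd p)"] by simp
    then have dd: "int d dvd fst p" "int d dvd snd p" by auto
    have d0: "d > 0"
    proof (rule Nat.gr0I)
      assume "d = 0"
      with d have "nat (gcd (fst p) (snd p)) = 0" by simp
      with g show False using gcd_ge_0_int[of "fst p" "snd p"] by linarith
    qed
    have "real d \<le> sqrt x" using p d0 dd by (rule common_divisor_le_sqrt)
    then have "d \<le> N" unfolding N_def by (simp add: le_nat_floor)
    then show "d \<in> {d\<in>{1..N}. int d dvd fst p \<and> int d dvd snd p}" using d0 dd by simp
  next
    fix d assume "d \<in> {d\<in>{1..N}. int d dvd fst p \<and> int d dvd snd p}"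
    then have "int d dvd gcd (fst p) (snd p)" by simp
    then show "d \<in> {d. d dvd nat (gcd (fst p) (snd p))}"
      using dvd_nat_abs_iff[of d "gcd (fst p) (snd p)"] by simp
  qed
  have "real (card {p \<in> disc_points x. coprime (fst p) (snd p)})
      = (\<Sum>p\<in>disc_points x. if coprime (fst p) (snd p) then 1 else 0)"
    by (simp add: sum.If_cases Int_def)
  also have "\<dots> = (\<Sum>p\<in>disc_points x. \<Sum>d | d dvd nat (gcd (fst p) (snd p)). moebius_mu d)"
  proof (rule sum.cong[OF refl])
    fix p assume "p \<in> disc_points x"
    then have "gcd (fst p) (snd p) \<noteq> 0" by (auto simp: disc_points_def prod_eq_iff)
    then have "gcd (fst p) (snd p) > 0" using gcd_ge_0_int[of "fst p" "snd p"] by linarith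
    then show "(if coprime (fst p) (snd p) then 1 else 0)
        = (\<Sum>d | d dvd nat (gcd (fst p) (snd p)). moebius_mu d)"
      by (subst sum_moebius_mu_divisors) (auto simp: coprime_iff_gcd_eq_1)
  qed
  also have "\<dots> = (\<Sum>p\<in>disc_points x. \<Sum>d\<in>{d\<in>{1..N}. int d dvd fst p \<and> int d dvd snd p}. moebius_mu d)"
    by (intro sum.cong) (simp_all add: dvds)
  also have "\<dots> = (\<Sum>d=1..N. \<Sum>p\<in>{p\<in>disc_points x. int d dvd fst p \<and> int d dvd snd p}. moebius_mu d)"
    by (rule sum.swap_restrict) auto
  also have "\<dots> = (\<Sum>d=1..N. moebius_mu d * real (card (disc_points (x / real d ^ 2))))"
    by (intro sum.cong) (auto simp: card_disc_points_multiples mult.commute)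
  finally show ?thesis .
qed

text \<open>Replacing each disc count by its area costs 33 \<open>sqrt x\<close> / d, which adds up
  to a harmonic sum. Completing the truncated Moebius series to 6 / pi^2 costs at most 8
  \<open>sqrt x\<close>, and 41 = 33 + 8.\<close>

lemma card_coprime_disc_points_bound:
  assumes "1 \<le> x"
  shows "\<bar>real (card {p \<in> disc_points x. coprime (fst p) (snd p)}) - 6 / pi * x\<bar>
    \<le> sqrt x * (41 + 33 * ln x)"
proof -
  define N where "N = nat \<lfloor>sqrt x\<rfloor>"
  have sx: "1 \<le> sqrt x" using assms by simp
  have N: "1 \<le> N" "real N \<le> sqrt x" "sqrt x < real N + 1"
    using sx unfolding N_def by linarith+
  \<comment> \<open>For d up to \<open>N\<close> the scaled squared radius is still at least 1, as
    the disc estimate requires.\<close>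
  have dx: "1 \<le> x / real d ^ 2" "sqrt (x / real d ^ 2) = sqrt x * inverse (real d)"
    if "d \<in> {1..N}" for d
  proof -
    have "real d \<le> sqrt x" using that N by simp
    then have "real d ^ 2 \<le> x"
      using assms by (metis of_nat_0_le_iff power_mono real_sqrt_pow2 order_trans zero_le_one)
    then show "1 \<le> x / real d ^ 2" using that by (simp add: field_simps)
    show "sqrt (x / real d ^ 2) = sqrt x * inverse (real d)"
      by (simp add: real_sqrt_divide field_simps)
  qed
  define P where "P = real (card {p \<in> disc_points x. coprime (fst p) (snd p)})"
  define m where "m = (\<Sum>d=1..N. moebius_mu d / real d ^ 2)"
  have "P - pi * x * m
      = (\<Sum>d=1..N. moebius_mu d * (real (card (disc_points (x / real d ^ 2))) - pi * (x / real d ^ 2)))"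
    unfolding P_def m_def N_def card_coprime_disc_points sum_distrib_left sum_subtractf[symmetric]
    by (intro sum.cong) (simp_all add: algebra_simps)
  also have "\<bar>\<dots>\<bar> \<le> (\<Sum>d=1..N. 33 * sqrt x * inverse (real d))"
  proof (rule order_trans[OF sum_abs], rule sum_mono)
    fix d assume d: "d \<in> {1..N}"
    have "\<bar>real (card (disc_points (x / real d ^ 2))) - pi * (x / real d ^ 2)\<bar> \<le> 33 * sqrt (x / real d ^ 2)"
      using dx(1)[OF d] by (rule card_disc_points_bound)
    then have "\<bar>moebius_mu d\<bar> * \<bar>real (card (disc_points (x / real d ^ 2))) - pi * (x / real d ^ 2)\<bar>
       \<le> 1 * (33 * sqrt (x / real d ^ 2))"
      by (intro mult_mono abs_moebius_mu_le_1) auto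
    then show "\<bar>moebius_mu d * (real (card (disc_points (x / real d ^ 2))) - pi * (x / real d ^ 2))\<bar>
      \<le> 33 * sqrt x * inverse (real d)"
      unfolding dx(2)[OF d] abs_mult by simp
  qed
  also have "\<dots> = 33 * sqrt x * harm N" by (simp add: harm_def sum_distrib_left)
  also have "\<dots> \<le> 33 * sqrt x * (1 + ln x)"
  proof -
    have "sqrt x \<le> x" using assms sx mult_left_mono[of 1 "sqrt x" "sqrt x"] by simp
    then have "ln (real N) \<le> ln x" using N by simp
    then have "harm N \<le> 1 + ln x" using harm_le_1_plus_ln[of N] N by simp
    then show ?thesis using sx by (intro mult_left_mono) auto
  qed
  finally have 1: "\<bar>P - pi * x * m\<bar> \<le> 33 * sqrt x * (1 + ln x)" .
  have "\<bar>pi * x * m - 6 / pi * x\<bar> = pi * x * \<bar>m - 6 / pi\<^sup>2\<bar>"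
  proof -
    have "pi * x * m - 6 / pi * x = pi * x * (m - 6 / pi\<^sup>2)"
      by (simp add: field_simps power2_eq_square)
    then show ?thesis using assms by (simp add: abs_mult)
  qed
  also have "\<dots> \<le> 4 * x * (2 / sqrt x)"
  proof -
    have "\<bar>m - 6 / pi\<^sup>2\<bar> \<le> 1 / N" unfolding m_def using N by (intro sum_moebius_mu_tail) simp
    also have "\<dots> \<le> 2 / sqrt x"
    proof -
      \<comment> \<open>Here \<open>sqrt x\<close> < N + 1 and N + 1 is at most 2 N.\<close>
      have "sqrt x \<le> 2 * real N" "0 < real N" using N by linarith+
      then show ?thesis using sx by (simp add: divide_simps)
    qed
    finally show ?thesis using assms pi_less_4 by (intro mult_mono) auto
  qed
  also have "\<dots> = 8 * sqrt x"
    using assms real_div_sqrt[of x] by simp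
  finally have 2: "\<bar>pi * x * m - 6 / pi * x\<bar> \<le> 8 * sqrt x" .
  have "\<bar>P - 6 / pi * x\<bar> \<le> \<bar>P - pi * x * m\<bar> + \<bar>pi * x * m - 6 / pi * x\<bar>" by simp
  also have "\<dots> \<le> 33 * sqrt x * (1 + ln x) + 8 * sqrt x" using 1 2 by (rule add_mono)
  also have "\<dots> = sqrt x * (41 + 33 * ln x)" by (simp add: algebra_simps)
  finally show ?thesis unfolding P_def .
qed

text \<open>Only the versions with explicit constants need estimates; the others follow from the
  values pi/4 and pi^2/6 of the two series.\<close>

theorem theoremB1:
  shows "(\<lambda>x::real. (\<Sum>n | 1 \<le> n \<and> real n \<le> x. real (b_square n))
            - dirichlet_L chi_minus4 1 * x) \<in> O[at_top](\<lambda>x. sqrt x)  \<and>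
         (\<lambda>x::real. (\<Sum>n | 1 \<le> n \<and> real n \<le> x. real (b_square n))
            - pi / 4 * x) \<in> O[at_top](\<lambda>x. sqrt x)  \<and>
         (\<lambda>x::real. (\<Sum>n | 1 \<le> n \<and> real n \<le> x. real (b_square_pr n))
            - dirichlet_L chi_minus4 1 / riemann_zeta 2 * x) \<in> O[at_top](\<lambda>x. sqrt x * ln x)  \<and>
         (\<lambda>x::real. (\<Sum>n | 1 \<le> n \<and> real n \<le> x. real (b_square_pr n))
            - 3 / (2 * pi) * x) \<in> O[at_top](\<lambda>x. sqrt x * ln x)"
proof -
  have 1: "(\<lambda>x::real. (\<Sum>n | 1 \<le> n \<and> real n \<le> x. real (b_square n)) - pi / 4 * x)
      \<in> O[at_top](\<lambda>x. sqrt x)"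
  proof (rule bigoI[where c = 33])
    show "\<forall>\<^sub>F x in at_top. norm ((\<Sum>n | 1 \<le> n \<and> real n \<le> x. real (b_square n)) - pi / 4 * x)
        \<le> 33 * norm (sqrt x)"
      using eventually_ge_at_top[of 1]
    proof eventually_elim
      case (elim x)
      then show ?case using sum_b_square[of x] card_disc_points_bound[of x]
        by (simp add: abs_le_iff)
    qed
  qed
  have 2: "(\<lambda>x::real. (\<Sum>n | 1 \<le> n \<and> real n \<le> x. real (b_square_pr n)) - 3 / (2 * pi) * x)
      \<in> O[at_top](\<lambda>x. sqrt x * ln x)"
  \<comment> \<open>74 = 41 + 33: from x = e onwards \<open>ln x\<close> is at least 1 and absorbs
    the constant term 41.\<close>
  proof (rule bigoI[where c = 74])
    show "\<forall>\<^sub>F x in at_top. norm ((\<Sum>n | 1 \<le> n \<and> real n \<le> x. real (b_square_pr n)) - 3 / (2 * pi) * x)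
        \<le> 74 * norm (sqrt x * ln x)"
      using eventually_ge_at_top[of "exp 1"]
    proof eventually_elim
      case (elim x)
      have x: "1 \<le> x" using elim exp_ge_add_one_self[of 1] by linarith
      have ln: "1 \<le> ln x" using elim x by (subst ln_ge_iff) auto
      define B where "B = (\<Sum>n | 1 \<le> n \<and> real n \<le> x. real (b_square_pr n))"
      \<comment> \<open>The factor 4 is inserted because the lattice points count each ideal four
        times; it turns the main term into 6 / pi * x.\<close>
      have "\<bar>B - 3 / (2 * pi) * x\<bar> \<le> 4 * \<bar>B - 3 / (2 * pi) * x\<bar>" by simp
      also have "\<dots> = \<bar>4 * B - 6 / pi * x\<bar>" by (simp add: abs_if)
      also have "\<dots> \<le> sqrt x * (41 + 33 * ln x)"
        unfolding B_def sum_b_square_pr using x by (rule card_coprime_disc_points_bound)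
      also have "\<dots> \<le> sqrt x * (74 * ln x)" using ln x by (intro mult_left_mono) auto
      finally have "\<bar>B - 3 / (2 * pi) * x\<bar> \<le> 74 * (sqrt x * ln x)" by simp
      then show ?case unfolding B_def using ln x by simp
    qed
  qed
  have "dirichlet_L chi_minus4 1 / riemann_zeta 2 = 3 / (2 * pi)"
    by (simp add: dirichlet_L_chi_minus4 riemann_zeta_2 field_simps power2_eq_square)
  with 1 2 show ?thesis by (simp only: dirichlet_L_chi_minus4)
qed

end
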